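(* Let $\mathcal{H}$ be a complex Hilbert space and let $0\ne T\in\mathcal{B}(\mathcal{H})$ have, with respect to an orthogonal decomposition $\mathcal{H}=\mathcal{G}\oplus\mathcal{G}^{\perp}$, the block matrix form $$T=\begin{pmatrix} S & R\\ 0 & Q\end{pmatrix},$$ where $\frac{1}{\|T\|}S$ is an isometry on $\mathcal{G}$ and, in addition, either $R\in\mathcal{B}(\mathcal{G}^{\perp},\mathcal{G})$ is injective and $Q\in\mathcal{B}(\mathcal{G}^{\perp})$ is arbitrary, or $Q^2=0$ (with $R\in\mathcal{B}(\mathcal{G}^{\perp},\mathcal{G})$ arbitrary). If $T$ satisfies $|T|\le|\mathrm{Re}\,T|$, then $T$ is self-adjoint.
   Context: $\mathcal{B}(\mathcal{H},\mathcal{K})$ is the space of bounded linear operators from $\mathcal{H}$ to $\mathcal{K}$, and $\mathcal{B}(\mathcal{H})=\mathcal{B}(\mathcal{H},\mathcal{H})$. For $T\in\mathcal{B}(\mathcal{H})$, $|T|=(T^*T)^{1/2}$ and $\mathrm{Re}\,T=\frac12(T+T^* )$; inequalities between self-adjoint operators are in the usual order. $\mathcal{G}$ is a closed subspace of $\mathcal{H}$. *)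

theory Defs
  imports "HOL-Analysis.Analysis"
begin

text \<open>Complex Hilbert spaces of arbitrary dimension. The inner product is linear in its first
  argument. Completeness and the real normed structure come from the class \<open>banach\<close>; two axioms tie
  them to the complex structure.\<close>

class complex_hilbert = banach +
  fixes scaleC :: "complex \<Rightarrow> 'a \<Rightarrow> 'a" (infixr "*\<^sub>C" 75)
    and cinner :: "'a \<Rightarrow> 'a \<Rightarrow> complex"
  assumes scaleC_add_right: "c *\<^sub>C (x + y) = c *\<^sub>C x + c *\<^sub>C y"
    and scaleC_add_left: "(c + d) *\<^sub>C x = c *\<^sub>C x + d *\<^sub>C x"
    and scaleC_scaleC: "c *\<^sub>C d *\<^sub>C x = (c * d) *\<^sub>C x"
    and scaleC_of_real: "complex_of_real r *\<^sub>C x = r *\<^sub>R x"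
    and cinner_commute: "cinner x y = cnj (cinner y x)"
    and cinner_add_left: "cinner (x + y) z = cinner x z + cinner y z"
    and cinner_scaleC_left: "cinner (c *\<^sub>C x) y = c * cinner x y"
    and cinner_self_nonneg: "0 \<le> Re (cinner x x)"
    and cinner_self_eq_0_iff: "cinner x x = 0 \<longleftrightarrow> x = 0"
    and norm_eq_sqrt_cinner: "norm x = sqrt (Re (cinner x x))"

definition closed_csubspace :: "'a::complex_hilbert set \<Rightarrow> bool" where
  "closed_csubspace G \<longleftrightarrow> closed G \<and> subspace G \<and> (\<forall>c. \<forall>x\<in>G. c *\<^sub>C x \<in> G)"

definition orth_compl :: "'a::complex_hilbert set \<Rightarrow> 'a set" where
  "orth_compl G = {y. \<forall>x\<in>G. cinner y x = 0}"

text \<open>An operator between subspaces \<open>V\<close> and \<open>W\<close> is represented by a function on the ambient types,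
  whose values outside \<open>V\<close> are irrelevant.\<close>

definition bounded_ops :: "'a::complex_hilbert set \<Rightarrow> 'b::complex_hilbert set \<Rightarrow> ('a \<Rightarrow> 'b) set" where
  "bounded_ops V W = {A. (\<forall>x\<in>V. A x \<in> W)
     \<and> (\<forall>x\<in>V. \<forall>y\<in>V. A (x + y) = A x + A y)
     \<and> (\<forall>c. \<forall>x\<in>V. A (c *\<^sub>C x) = c *\<^sub>C A x)
     \<and> (\<exists>K. \<forall>x\<in>V. norm (A x) \<le> K * norm x)}"

definition isometry_on :: "'a::complex_hilbert set \<Rightarrow> ('a \<Rightarrow> 'b::complex_hilbert) \<Rightarrow> bool" where
  "isometry_on V A \<longleftrightarrow> (\<forall>x\<in>V. norm (A x) = norm x)"

text \<open>\<open>T\<close> is the block matrix with rows \<open>(A, B)\<close> and \<open>(C, D)\<close> with respect to \<open>G\<close> and its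
  orthogonal complement.\<close>

definition has_block_form ::
  "'a::complex_hilbert set \<Rightarrow> ('a \<Rightarrow> 'a) \<Rightarrow> ('a \<Rightarrow> 'a) \<Rightarrow> ('a \<Rightarrow> 'a) \<Rightarrow> ('a \<Rightarrow> 'a) \<Rightarrow> ('a \<Rightarrow> 'a) \<Rightarrow> bool" where
  "has_block_form G T A B C D \<longleftrightarrow>
     A \<in> bounded_ops G G \<and> B \<in> bounded_ops (orth_compl G) G \<and>
     C \<in> bounded_ops G (orth_compl G) \<and> D \<in> bounded_ops (orth_compl G) (orth_compl G) \<and>
     (\<forall>x\<in>G. \<forall>y\<in>orth_compl G. T (x + y) = (A x + B y) + (C x + D y))"

text \<open>The objects selected by \<open>THE\<close> below exist and are unique for bounded \<open>T\<close> (and, for the square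
  root, positive \<open>A\<close>).\<close>

definition cadjoint :: "('a::complex_hilbert \<Rightarrow> 'a) \<Rightarrow> 'a \<Rightarrow> 'a" where
  "cadjoint T = (THE A. A \<in> bounded_ops UNIV UNIV \<and> (\<forall>x y. cinner (T x) y = cinner x (A y)))"

definition selfadjoint_op :: "('a::complex_hilbert \<Rightarrow> 'a) \<Rightarrow> bool" where
  "selfadjoint_op T \<longleftrightarrow> T \<in> bounded_ops UNIV UNIV \<and> cadjoint T = T"

definition positive_op :: "('a::complex_hilbert \<Rightarrow> 'a) \<Rightarrow> bool" where
  "positive_op A \<longleftrightarrow> A \<in> bounded_ops UNIV UNIV \<and> (\<forall>x. cinner (A x) x \<in> \<real> \<and> 0 \<le> Re (cinner (A x) x))"

definition op_le :: "('a::complex_hilbert \<Rightarrow> 'a) \<Rightarrow> ('a \<Rightarrow> 'a) \<Rightarrow> bool" where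
  "op_le A B \<longleftrightarrow> selfadjoint_op A \<and> selfadjoint_op B \<and> positive_op (\<lambda>x. B x - A x)"

definition op_sqrt :: "('a::complex_hilbert \<Rightarrow> 'a) \<Rightarrow> 'a \<Rightarrow> 'a" where
  "op_sqrt A = (THE B. positive_op B \<and> B \<circ> B = A)"

definition op_abs :: "('a::complex_hilbert \<Rightarrow> 'a) \<Rightarrow> 'a \<Rightarrow> 'a" where
  "op_abs T = op_sqrt (cadjoint T \<circ> T)"

definition op_Re :: "('a::complex_hilbert \<Rightarrow> 'a) \<Rightarrow> 'a \<Rightarrow> 'a" where
  "op_Re T = (\<lambda>x. (1/2) *\<^sub>C (T x + cadjoint T x))"

end

theory Submission
  imports Defs
begin

text \<open>For \<open>g\<close> in \<open>G\<close> we have \<open>\<parallel>T g\<parallel> = \<parallel>T\<parallel> \<parallel>g\<parallel>\<close>, so \<open>|T| g = \<parallel>T\<parallel> g\<close>, and \<open>|T| \<le> |Re T|\<close> forces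
  \<open>\<parallel>(T + T\<^sup>*) g\<parallel> \<ge> 2 \<parallel>T\<parallel> \<parallel>g\<parallel>\<close>. The parallelogram law then gives \<open>T g = T\<^sup>* g\<close>, hence \<open>R = 0\<close>. If
  \<open>R\<close> is injective, the complement of \<open>G\<close> is trivial. If \<open>Q\<^sup>2 = 0\<close>, then on the range of \<open>Q\<^sup>*\<close> the
  operator \<open>|Re Q|\<close> has only half the size of \<open>|Q|\<close>, so \<open>|Q| \<le> |Re Q|\<close> halves every bound on
  \<open>\<parallel>Q\<parallel>\<close>, and \<open>Q = 0\<close>.\<close>

section \<open>Geometry of complex Hilbert spaces\<close>

lemma cinner_add_right: "cinner x (y + z) = cinner x y + cinner (x::'a::complex_hilbert) z"
  by (metis cinner_commute cinner_add_left complex_cnj_add)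

lemma cinner_scaleC_right: "cinner x (c *\<^sub>C y) = cnj c * cinner (x::'a::complex_hilbert) y"
  by (metis cinner_commute cinner_scaleC_left complex_cnj_mult)

lemma cinner_zero_left: "cinner 0 (x::'a::complex_hilbert) = 0"
  using cinner_add_left[of 0 0 x] by simp

text \<open>The geometry and duality arguments run in the underlying real Hilbert space; complex
  identities are recovered by also testing with multiples by \<open>\<i>\<close>.\<close>

definition rinner :: "'a::complex_hilbert \<Rightarrow> 'a \<Rightarrow> real" where
  "rinner x y = Re (cinner x y)"

lemma rinner_commute: "rinner x y = rinner y x"
  unfolding rinner_def by (metis cinner_commute cnj.sel(1))

lemma rinner_self: "rinner x x = (norm x)\<^sup>2"
  by (simp add: rinner_def norm_eq_sqrt_cinner cinner_self_nonneg)

lemma rinner_add_left: "rinner (x + y) z = rinner x z + rinner y z"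
  by (simp add: rinner_def cinner_add_left)

lemma rinner_scaleR_left: "rinner (r *\<^sub>R x) y = r * rinner x y"
  by (simp add: rinner_def cinner_scaleC_left flip: scaleC_of_real)

text \<open>Semidefiniteness is enough, so the inequality serves both \<open>rinner\<close> and the
  possibly degenerate form \<open>rinner (A x) y\<close> of a positive operator.\<close>

lemma Cauchy_Schwarz_form:
  fixes b :: "'a::real_vector \<Rightarrow> 'a \<Rightarrow> real"
  assumes add: "\<And>x y z. b (x + y) z = b x z + b y z"
    and scale: "\<And>r x y. b (r *\<^sub>R x) y = r * b x y"
    and sym: "\<And>x y. b x y = b y x"
    and nonneg: "\<And>x. 0 \<le> b x x"
  shows "(b x y)\<^sup>2 \<le> b x x * b y y"
proof -
  have add': "b z (x + y) = b z x + b z y" for x y z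
    by (metis add sym)
  have scale': "b x (r *\<^sub>R y) = r * b x y" for r x y
    by (metis scale sym)
  have expand: "0 \<le> b x x + 2 * s * b x y + s\<^sup>2 * b y y" for s
    using nonneg[of "x + s *\<^sub>R y"] sym[of y x]
    by (simp add: add add' scale scale' power2_eq_square algebra_simps)
  show ?thesis
  proof (cases "b y y = 0")
    case True
    have "b x y = 0"
    proof (rule ccontr)
      assume "b x y \<noteq> 0"
      \<comment> \<open>With \<open>b y y = 0\<close> the expansion is affine in \<open>s\<close>;
        this value of \<open>s\<close> makes it -1.\<close>
      then have "2 * (- (b x x + 1) / (2 * b x y)) * b x y = - (b x x + 1)" by simp
      then show False
        using expand[of "- (b x x + 1) / (2 * b x y)"] True by simp
    qed
    then show ?thesis using True by simp
  next
    case False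
    then have "0 < b y y" using nonneg[of y] by simp
    \<comment> \<open>The value of \<open>s\<close> is the minimizer of the quadratic in
      \<open>expand\<close>.\<close>
    then show ?thesis
      using expand[of "- b x y / b y y"]
      by (simp add: field_simps power2_eq_square)
  qed
qed

lemma rinner_bound: "\<bar>rinner x y\<bar> \<le> norm x * norm y"
proof -
  have "(rinner x y)\<^sup>2 \<le> rinner x x * rinner y y"
    by (intro Cauchy_Schwarz_form rinner_add_left rinner_scaleR_left rinner_commute)
      (simp add: rinner_self)
  then have "\<bar>rinner x y\<bar>\<^sup>2 \<le> (norm x * norm y)\<^sup>2"
    by (simp add: rinner_self power_mult_distrib)
  then show ?thesis by (rule power2_le_imp_le) simp
qed

lemma rinner_le: "rinner x y \<le> norm x * norm y"
  using rinner_bound[of x y] by simp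

interpretation rinner: bounded_bilinear rinner
proof
  show "\<exists>K. \<forall>x y. norm (rinner x y) \<le> norm x * norm y * K"
    using rinner_bound by (intro exI[of _ 1]) auto
  show "rinner x (y + z) = rinner x y + rinner x z" for x y z :: 'a
    by (metis rinner_commute rinner_add_left)
  show "rinner x (r *\<^sub>R y) = r *\<^sub>R rinner x y" for r and x y :: 'a
    by (metis rinner_commute rinner_scaleR_left real_scaleR_def)
qed (simp_all add: rinner_add_left rinner_scaleR_left)

lemma rinner_scaleR_right: "rinner x (r *\<^sub>R y) = r * rinner x y"
  by (simp add: rinner.scaleR_right)

lemmas rinner_expand = rinner.add_left rinner.add_right rinner.diff_left rinner.diff_right
  rinner_scaleR_left rinner_scaleR_right

lemma norm_add_square: "(norm (x + y))\<^sup>2 = (norm x)\<^sup>2 + 2 * rinner x y + (norm y)\<^sup>2"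
  by (simp add: rinner_expand rinner_commute[of y x] flip: rinner_self)

lemma norm_diff_square: "(norm (x - y))\<^sup>2 = (norm x)\<^sup>2 - 2 * rinner x y + (norm y)\<^sup>2"
  by (simp add: rinner_expand rinner_commute[of y x] flip: rinner_self)

lemma rinner_eqI:
  assumes "\<And>x. rinner x y = rinner x z"
  shows "y = z"
proof -
  have "rinner (y - z) (y - z) = 0" using assms by (simp add: rinner.diff_right)
  then show ?thesis by (simp add: rinner_self)
qed

lemma cinner_eq_rinner:
  "cinner x y = Complex (rinner x y) (- rinner (\<i> *\<^sub>C x) y)"
  by (simp add: complex_eq_iff rinner_def cinner_scaleC_left)

lemma norm_scaleC: "norm (c *\<^sub>C x) = cmod c * norm (x::'a::complex_hilbert)"
proof -
  have "cinner (c *\<^sub>C x) (c *\<^sub>C x) = complex_of_real ((cmod c)\<^sup>2) * cinner x x"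
    by (simp only: cinner_scaleC_left cinner_scaleC_right complex_norm_square mult_ac)
  then have "(norm (c *\<^sub>C x))\<^sup>2 = (cmod c * norm x)\<^sup>2"
    by (simp add: rinner_def power_mult_distrib flip: rinner_self)
  then show ?thesis by simp
qed

lemma bounded_linear_scaleC: "bounded_linear (\<lambda>x::'a::complex_hilbert. c *\<^sub>C x)"
proof (rule bounded_linear_intro)
  show "c *\<^sub>C (r *\<^sub>R x) = r *\<^sub>R (c *\<^sub>C x)" for r and x :: 'a
    by (simp add: scaleC_scaleC mult.commute flip: scaleC_of_real)
  show "norm (c *\<^sub>C x) \<le> norm x * cmod c" for x :: 'a
    by (simp add: norm_scaleC mult.commute)
qed (rule scaleC_add_right)

text \<open>A sequence in \<open>V\<close> minimizing the distance to \<open>z\<close> is Cauchy by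
  the parallelogram law, and its limit is the nearest point \<open>x\<close>; minimality makes
  \<open>z - x\<close> orthogonal to \<open>V\<close>. Real subspaces are allowed because the Riesz
  argument uses the kernel of a real functional.\<close>

lemma closed_subspace_orth_decomp:
  fixes V :: "'a::complex_hilbert set"
  assumes "closed V" and "subspace V"
  obtains x y where "x \<in> V" "z = x + y" "\<And>v. v \<in> V \<Longrightarrow> rinner y v = 0"
proof -
  define d where "d = infdist z V"
  have ne: "V \<noteq> {}" using \<open>subspace V\<close> subspace_0 by blast
  have d_le: "d \<le> norm (z - v)" if "v \<in> V" for v
    using infdist_le[OF that, of z] by (simp add: d_def dist_norm)
  have d0: "0 \<le> d" by (simp add: d_def infdist_nonneg)
  have "\<exists>v\<in>V. norm (z - v) < d + 1 / Suc n" for n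
  proof (rule ccontr)
    assume "\<not> ?thesis"
    then have "d + 1 / Suc n \<le> infdist z V"
      using ne unfolding infdist_def by (auto intro!: cINF_greatest simp: dist_norm not_less)
    then show False unfolding d_def by simp
  qed
  then obtain v where vV: "\<And>n. v n \<in> V" and v: "\<And>n. norm (z - v n) < d + 1 / Suc n"
    by metis
  have lim: "(\<lambda>n. norm (z - v n)) \<longlonglongrightarrow> d"
  proof (rule tendsto_sandwich[OF _ _ tendsto_const])
    show "(\<lambda>n. d + 1 / Suc n) \<longlonglongrightarrow> d"
      using tendsto_add[OF tendsto_const[of d] LIMSEQ_inverse_real_of_nat]
      by (simp add: inverse_eq_divide)
    show "\<forall>\<^sub>F n in sequentially. norm (z - v n) \<le> d + 1 / Suc n"
      using v by (intro always_eventually allI less_imp_le)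
  qed (simp add: d_le vV)
  have "Cauchy v"
  proof (rule metric_CauchyI)
    fix e :: real assume "0 < e"
    have "(\<lambda>n. (norm (z - v n))\<^sup>2) \<longlonglongrightarrow> d\<^sup>2" by (intro tendsto_intros lim)
    then have "\<forall>\<^sub>F n in sequentially. (norm (z - v n))\<^sup>2 < d\<^sup>2 + e\<^sup>2 / 4"
      by (rule order_tendstoD) (use \<open>0 < e\<close> in simp)
    then obtain N where N: "\<And>n. n \<ge> N \<Longrightarrow> (norm (z - v n))\<^sup>2 < d\<^sup>2 + e\<^sup>2 / 4"
      by (auto simp: eventually_sequentially)
    show "\<exists>M. \<forall>m\<ge>M. \<forall>n\<ge>M. dist (v m) (v n) < e"
    proof (intro exI allI impI)
      fix m n assume "N \<le> m" "N \<le> n"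
      \<comment> \<open>The midpoint is again at distance at least \<open>d\<close> from
        \<open>z\<close>, so the identity below leaves less than
        \<open>4 * (d\<^sup>2 + e\<^sup>2 / 4) - 4 * d\<^sup>2 = e\<^sup>2\<close>.\<close>
      have "(1/2) *\<^sub>R (v m + v n) \<in> V"
        using vV \<open>subspace V\<close> by (simp add: subspace_add subspace_scale)
      then have "d \<le> norm (z - (1/2) *\<^sub>R (v m + v n))" by (rule d_le)
      then have "d\<^sup>2 \<le> (norm (z - (1/2) *\<^sub>R (v m + v n)))\<^sup>2"
        using d0 by (rule power_mono)
      moreover have "(norm (v m - v n))\<^sup>2 = 2 * (norm (z - v m))\<^sup>2 + 2 * (norm (z - v n))\<^sup>2
          - 4 * (norm (z - (1/2) *\<^sub>R (v m + v n)))\<^sup>2"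
      proof -
        define p q where "p = z - v m" and "q = z - v n"
        have "v m - v n = q - p" and "z - (1/2) *\<^sub>R (v m + v n) = (1/2) *\<^sub>R (p + q)"
          by (simp_all add: p_def q_def scaleR_add_right scaleR_diff_right)
            (metis add_diff_eq diff_add_eq field_sum_of_halves scaleR_left.add scaleR_one)
        moreover have "4 * (norm ((1/2) *\<^sub>R (p + q)))\<^sup>2 = (norm (p + q))\<^sup>2"
          by (simp only: norm_scaleR power_mult_distrib) (simp add: power2_eq_square)
        ultimately show ?thesis
          using norm_add_square[of p q] norm_diff_square[of q p] rinner_commute[of q p]
          unfolding p_def[symmetric] q_def[symmetric] by simp
      qed
      ultimately have "(norm (v m - v n))\<^sup>2 < e\<^sup>2"
        using N[OF \<open>N \<le> m\<close>] N[OF \<open>N \<le> n\<close>] by simp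
      then show "dist (v m) (v n) < e"
        using \<open>0 < e\<close> by (simp add: dist_norm power2_less_imp_less)
    qed
  qed
  then obtain x where x: "v \<longlonglongrightarrow> x" by (auto simp: Cauchy_convergent_iff convergent_def)
  have xV: "x \<in> V" using closed_sequentially[OF \<open>closed V\<close> _ x] vV by blast
  have "(\<lambda>n. norm (z - v n)) \<longlonglongrightarrow> norm (z - x)" by (intro tendsto_intros x)
  then have dx: "norm (z - x) = d" using lim LIMSEQ_unique by blast
  show thesis
  proof (rule that[of x "z - x"])
    fix w assume "w \<in> V"
    define r where "r = rinner (z - x) w"
    have "0 \<le> s\<^sup>2 * (norm w)\<^sup>2 - 2 * s * r" for s
    proof -
      have "x + s *\<^sub>R w \<in> V"
        using xV \<open>w \<in> V\<close> \<open>subspace V\<close> by (simp add: subspace_add subspace_scale)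
      then have "d \<le> norm ((z - x) - s *\<^sub>R w)" using d_le by (simp add: diff_diff_add)
      then have "(norm (z - x))\<^sup>2 \<le> (norm ((z - x) - s *\<^sub>R w))\<^sup>2"
        using d0 by (simp add: dx power_mono)
      then show ?thesis
        by (simp add: norm_diff_square[of "z - x"] rinner_scaleR_right power_mult_distrib r_def)
    qed
    \<comment> \<open>At this minimizing \<open>s\<close> the inequality reads
      \<open>0 \<le> - r\<^sup>2 / (norm w)\<^sup>2\<close>; for \<open>w = 0\<close> the claim is
      trivial.\<close>
    from this[of "r / (norm w)\<^sup>2"] show "rinner (z - x) w = 0"
      by (cases "w = 0") (auto simp: r_def rinner.zero_right power2_eq_square field_simps
          mult_le_0_iff zero_le_mult_iff)
  qed (use xV in auto)
qed

text \<open>If \<open>y\<close> is orthogonal to the kernel and \<open>f y\<close> is nonzero, then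
  \<open>u - (f u / f y) *\<^sub>R y\<close> lies in the kernel for every \<open>u\<close>, so
  pairing it with \<open>y\<close> determines \<open>f u\<close>.\<close>

lemma riesz_representation:
  fixes f :: "'a::complex_hilbert \<Rightarrow> real"
  assumes "bounded_linear f"
  obtains y where "\<And>x. f x = rinner x y"
proof (cases "\<forall>x. f x = 0")
  case True
  then show thesis using that[of 0] by (simp add: rinner.zero_right)
next
  case False
  interpret f: bounded_linear f by fact
  obtain z where z: "f z \<noteq> 0" using False by blast
  let ?V = "{x. f x = 0}"
  have "closed ?V"
    by (intro closed_Collect_eq continuous_intros f.continuous_on)
  moreover have "subspace ?V"
    by (auto simp: subspace_def f.add f.scaleR f.zero)
  ultimately obtain x y where x: "x \<in> ?V" and zxy: "z = x + y"
    and y: "\<And>v. v \<in> ?V \<Longrightarrow> rinner y v = 0"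
    using closed_subspace_orth_decomp[of ?V z] by blast
  have fy: "f y \<noteq> 0" using z x zxy by (simp add: f.add)
  then have "y \<noteq> 0" using f.zero by auto
  show thesis
  proof (rule that[of "(f y / (norm y)\<^sup>2) *\<^sub>R y"])
    fix u
    have "u - (f u / f y) *\<^sub>R y \<in> ?V" using fy by (simp add: f.diff f.scaleR)
    from y[OF this] show "f u = rinner u ((f y / (norm y)\<^sup>2) *\<^sub>R y)"
      using fy \<open>y \<noteq> 0\<close>
      by (simp add: rinner_expand rinner_self rinner_commute[of y u] field_simps)
  qed
qed

section \<open>Bounded operators and their adjoints\<close>

lemma bounded_ops_UNIV_iff:
  "T \<in> bounded_ops UNIV UNIV \<longleftrightarrow> bounded_linear T \<and> (\<forall>c x. T (c *\<^sub>C x) = c *\<^sub>C T x)"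
proof
  assume T: "T \<in> bounded_ops UNIV UNIV"
  then obtain K where K: "\<And>x. norm (T x) \<le> K * norm x" by (auto simp: bounded_ops_def)
  have "bounded_linear T"
  proof (rule bounded_linear_intro)
    show "T (r *\<^sub>R x) = r *\<^sub>R T x" for r x
      using T by (simp add: bounded_ops_def flip: scaleC_of_real)
    show "norm (T x) \<le> norm x * K" for x using K by (simp add: mult.commute)
  qed (use T in \<open>simp add: bounded_ops_def\<close>)
  with T show "bounded_linear T \<and> (\<forall>c x. T (c *\<^sub>C x) = c *\<^sub>C T x)"
    by (simp add: bounded_ops_def)
next
  assume "bounded_linear T \<and> (\<forall>c x. T (c *\<^sub>C x) = c *\<^sub>C T x)"
  then show "T \<in> bounded_ops UNIV UNIV"
    using bounded_linear.bounded[of T]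
    by (auto simp: bounded_ops_def linear_simps mult.commute)
qed

text \<open>Testing at \<open>\<i> *\<^sub>C x\<close> as well supplies the imaginary parts, since
  \<open>T\<close> is complex linear.\<close>

lemma cinner_adjointI:
  assumes T: "T \<in> bounded_ops UNIV UNIV"
    and A: "\<And>x. rinner (T x) y = rinner x z"
  shows "cinner (T x) y = cinner x z"
  using T A[of x] A[of "\<i> *\<^sub>C x"] by (simp add: cinner_eq_rinner bounded_ops_UNIV_iff)

lemma rinner_of_cinner: "cinner x y = cinner u v \<Longrightarrow> rinner x y = rinner u v"
  by (simp add: rinner_def)

lemma cadjoint_eqI:
  assumes A: "A \<in> bounded_ops UNIV UNIV" "\<And>x y. cinner (T x) y = cinner x (A y)"
  shows "cadjoint T = A"
  unfolding cadjoint_def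
proof (rule the_equality)
  fix A' assume A': "A' \<in> bounded_ops UNIV UNIV \<and> (\<forall>x y. cinner (T x) y = cinner x (A' y))"
  show "A' = A"
  proof
    fix y
    show "A' y = A y"
      using A' A(2) by (intro rinner_eqI) (simp add: rinner_def)
  qed
qed (use A in blast)

text \<open>Riesz applied to the functional \<open>rinner (T x) y\<close> of \<open>x\<close>
  produces the value of the adjoint at \<open>y\<close>. This shows that the description in
  \<open>cadjoint_def\<close> is met.\<close>

lemma cadjoint:
  fixes T :: "'a::complex_hilbert \<Rightarrow> 'a"
  assumes T: "T \<in> bounded_ops UNIV UNIV"
  shows cadjoint_bounded_ops: "cadjoint T \<in> bounded_ops UNIV UNIV"
    and cinner_cadjoint: "cinner (T x) y = cinner x (cadjoint T y)"
proof -
  have lin: "bounded_linear T" using T by (simp add: bounded_ops_UNIV_iff)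
  have "\<exists>z. \<forall>x. rinner (T x) y = rinner x z" for y
    using riesz_representation[OF bounded_linear_compose[OF rinner.bounded_linear_left[of y] lin]]
    by metis
  then obtain A where A: "\<And>x y. rinner (T x) y = rinner x (A y)" by metis
  have cA: "cinner (T x) y = cinner x (A y)" for x y
    using T A by (rule cinner_adjointI)
  have "bounded_linear A"
  proof (rule bounded_linear_intro)
    show "A (x + y) = A x + A y" for x y
      by (rule rinner_eqI) (simp add: rinner.add_right flip: A)
    show "A (r *\<^sub>R x) = r *\<^sub>R A x" for r x
      by (rule rinner_eqI) (simp add: rinner_scaleR_right flip: A)
    show "norm (A y) \<le> norm y * onorm T" for y
    proof -
      have "norm (A y) * norm (A y) = rinner (T (A y)) y"
        by (simp add: A rinner_self power2_eq_square)
      also have "\<dots> \<le> norm (T (A y)) * norm y" by (rule rinner_le)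
      also have "\<dots> \<le> onorm T * norm (A y) * norm y"
        by (intro mult_right_mono onorm lin) simp
      finally show ?thesis
        using onorm_pos_le[OF lin] by (cases "A y = 0") (auto simp: mult_ac)
    qed
  qed
  moreover have "A (c *\<^sub>C y) = c *\<^sub>C A y" for c y
    by (rule rinner_eqI) (simp add: rinner_def cinner_scaleC_right flip: cA)
  ultimately have "A \<in> bounded_ops UNIV UNIV" by (simp add: bounded_ops_UNIV_iff)
  moreover from this cA have "cadjoint T = A" by (rule cadjoint_eqI)
  ultimately show "cadjoint T \<in> bounded_ops UNIV UNIV" "cinner (T x) y = cinner x (cadjoint T y)"
    using cA by simp_all
qed

lemma rinner_cadjoint:
  "T \<in> bounded_ops UNIV UNIV \<Longrightarrow> rinner (T x) y = rinner x (cadjoint T y)"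
  using cinner_cadjoint by (rule rinner_of_cinner)

lemma norm_cadjoint_le:
  assumes T: "T \<in> bounded_ops UNIV UNIV"
  shows "norm (cadjoint T y) \<le> onorm T * norm y"
proof -
  let ?z = "cadjoint T y"
  have lin: "bounded_linear T" using T by (simp add: bounded_ops_UNIV_iff)
  have "norm ?z * norm ?z = rinner (T ?z) y"
    by (simp add: rinner_cadjoint[OF T] rinner_self power2_eq_square)
  also have "\<dots> \<le> norm (T ?z) * norm y" by (rule rinner_le)
  also have "\<dots> \<le> onorm T * norm ?z * norm y"
    by (intro mult_right_mono onorm lin) simp
  finally show ?thesis
    using onorm_pos_le[OF lin] by (cases "?z = 0") (auto simp: mult_ac)
qed

section \<open>Positive operators and their square roots\<close>

lemma positive_op_bounded_linear: "positive_op A \<Longrightarrow> bounded_linear A"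
  by (simp add: positive_op_def bounded_ops_UNIV_iff)

text \<open>Polarization: the form is real on the diagonal, and evaluating it at
  \<open>x + y\<close> and at \<open>x + \<i> *\<^sub>C y\<close> compares imaginary and real
  parts.\<close>

lemma positive_op_cinner:
  fixes A :: "'a::complex_hilbert \<Rightarrow> 'a"
  assumes "positive_op A"
  shows "cinner (A x) y = cinner x (A y)"
proof -
  have add: "A (x + y) = A x + A y" and scale: "A (c *\<^sub>C x) = c *\<^sub>C A x" for c x y
    using assms by (simp_all add: positive_op_def bounded_ops_def)
  have real: "Im (cinner (A x) x) = 0" for x
    using assms by (simp add: positive_op_def complex_is_Real_iff)
  have *: "Im (cinner (A x) y) + Im (cinner (A y) x) = 0" for x y
    using real[of "x + y"] real[of x] real[of y]
    by (simp add: add cinner_add_left cinner_add_right)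
  have "cinner (A x) y = cnj (cinner (A y) x)"
    using *[of x y] *[of x "\<i> *\<^sub>C y"]
    by (simp add: complex_eq_iff scale cinner_scaleC_left cinner_scaleC_right)
  then show ?thesis by (metis cinner_commute)
qed

lemma positive_op_rinner: "positive_op A \<Longrightarrow> rinner (A x) y = rinner x (A y)"
  using positive_op_cinner by (rule rinner_of_cinner)

lemma positive_op_nonneg: "positive_op A \<Longrightarrow> 0 \<le> rinner (A x) x"
  by (simp add: positive_op_def rinner_def)

text \<open>For a complex linear map, symmetry of the real form upgrades to hermitian symmetry,
  which makes the diagonal real.\<close>

lemma positive_opI:
  assumes A: "A \<in> bounded_ops UNIV UNIV"
    and sym: "\<And>x y. rinner (A x) y = rinner x (A y)"
    and nonneg: "\<And>x. 0 \<le> rinner (A x) x"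
  shows "positive_op A"
proof -
  have "cinner (A x) x = cnj (cinner (A x) x)" for x
    using cinner_adjointI[OF A sym] by (metis cinner_commute)
  then have "cinner (A x) x \<in> \<real>" for x by (metis Reals_cnj_iff)
  then show ?thesis using A nonneg by (simp add: positive_op_def rinner_def)
qed

lemma positive_op_Cauchy_Schwarz:
  assumes A: "positive_op A"
  shows "(rinner (A x) y)\<^sup>2 \<le> rinner (A x) x * rinner (A y) y"
proof (rule Cauchy_Schwarz_form)
  show "rinner (A x) y = rinner (A y) x" for x y
    using positive_op_rinner[OF A] rinner_commute by metis
qed (use positive_op_nonneg[OF A] positive_op_bounded_linear[OF A] in
    \<open>simp_all add: linear_simps rinner_expand\<close>)

text \<open>Cauchy-Schwarz for the form of \<open>A\<close>, at \<open>x\<close> and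
  \<open>A x\<close>. The bound \<open>c\<close> is assumed at the single vector \<open>A x\<close>,
  so a bound valid only on an invariant set can be used.\<close>

lemma positive_op_norm_square_le:
  assumes A: "positive_op A" and c: "rinner (A (A x)) (A x) \<le> c * (norm (A x))\<^sup>2"
  shows "(norm (A x))\<^sup>2 \<le> c * rinner (A x) x"
proof (cases "A x = 0")
  case False
  have "((norm (A x))\<^sup>2)\<^sup>2 \<le> rinner (A x) x * rinner (A (A x)) (A x)"
    using positive_op_Cauchy_Schwarz[OF A, of x "A x"] by (simp add: rinner_self)
  also have "\<dots> \<le> rinner (A x) x * (c * (norm (A x))\<^sup>2)"
    by (intro mult_left_mono c positive_op_nonneg A)
  finally show ?thesis using False by (simp add: power2_eq_square mult_ac)
qed (simp add: rinner.zero_left)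

lemma positive_op_eq_0:
  assumes A: "positive_op A" and "rinner (A x) x = 0"
  shows "A x = 0"
  using positive_op_Cauchy_Schwarz[OF A, of x "A x"] assms(2) by (simp add: rinner_self)

text \<open>A solution of \<open>X = (C + X\<^sup>2) / 2\<close> satisfies \<open>(1 - X)\<^sup>2 = 1 - C\<close>. The scalar iteration for \<open>C = 1\<close>
  majorizes the operator iteration, which therefore converges in norm.\<close>

primrec sqrt_iter :: "('a::banach \<Rightarrow>\<^sub>L 'a) \<Rightarrow> nat \<Rightarrow> 'a \<Rightarrow>\<^sub>L 'a" where
  "sqrt_iter C 0 = 0"
| "sqrt_iter C (Suc n) = (1/2) *\<^sub>R (C + (sqrt_iter C n o\<^sub>L sqrt_iter C n))"

primrec sqrt_bound :: "nat \<Rightarrow> real" where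
  "sqrt_bound 0 = 0"
| "sqrt_bound (Suc n) = (1/2) * (1 + (sqrt_bound n)\<^sup>2)"

lemma sqrt_bound_range: "0 \<le> sqrt_bound n \<and> sqrt_bound n \<le> 1"
  by (induction n) (auto simp: power_le_one)

lemma sqrt_bound_mono: "incseq sqrt_bound"
proof (rule incseq_SucI)
  show "sqrt_bound n \<le> sqrt_bound (Suc n)" for n
    using zero_le_power2[of "1 - sqrt_bound n"] by (simp add: power2_diff)
qed

lemmas blinfun_compose_expand =
  bounded_bilinear.add_left[OF bounded_bilinear_blinfun_compose]
  bounded_bilinear.add_right[OF bounded_bilinear_blinfun_compose]
  bounded_bilinear.diff_left[OF bounded_bilinear_blinfun_compose]
  bounded_bilinear.diff_right[OF bounded_bilinear_blinfun_compose]
  bounded_bilinear.scaleR_left[OF bounded_bilinear_blinfun_compose]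
  bounded_bilinear.scaleR_right[OF bounded_bilinear_blinfun_compose]
  bounded_bilinear.zero_left[OF bounded_bilinear_blinfun_compose]
  bounded_bilinear.zero_right[OF bounded_bilinear_blinfun_compose]

text \<open>Each iterate is a polynomial in \<open>C\<close>. Consequently the iterates also commute
  with one another.\<close>

lemma sqrt_iter_commute:
  assumes "D o\<^sub>L C = C o\<^sub>L D"
  shows "D o\<^sub>L sqrt_iter C n = sqrt_iter C n o\<^sub>L D"
proof (induction n)
  case (Suc n)
  have "D o\<^sub>L (sqrt_iter C n o\<^sub>L sqrt_iter C n) = (sqrt_iter C n o\<^sub>L sqrt_iter C n) o\<^sub>L D"
    using arg_cong[OF Suc.IH, of blinfun_apply] by (intro blinfun_eqI) (simp add: fun_eq_iff)
  then show ?case using assms by (simp add: blinfun_compose_expand)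
qed (simp add: blinfun_compose_expand)

lemma norm_sqrt_iter:
  assumes "norm C \<le> 1"
  shows "norm (sqrt_iter C n) \<le> sqrt_bound n"
proof (induction n)
  case (Suc n)
  have "norm (sqrt_iter C n o\<^sub>L sqrt_iter C n) \<le> (sqrt_bound n)\<^sup>2"
    unfolding power2_eq_square
    by (rule order_trans[OF norm_blinfun_compose]) (intro mult_mono Suc; simp add: sqrt_bound_range)
  then show ?case
    using assms norm_triangle_ineq[of C "sqrt_iter C n o\<^sub>L sqrt_iter C n"] by simp
qed simp

text \<open>Since iterates commute, a difference of their squares factors as in the scalar case,
  which carries the estimate from one index to the next. The right-hand side telescopes, making the
  increments summable.\<close>

lemma norm_sqrt_iter_diff:
  assumes C: "norm C \<le> 1"
  shows "norm (sqrt_iter C (Suc n) - sqrt_iter C n) \<le> sqrt_bound (Suc n) - sqrt_bound n"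
proof (induction n)
  case 0
  show ?case using C by (simp add: blinfun_compose_expand)
next
  case (Suc n)
  define X Y where "X = sqrt_iter C n" and "Y = sqrt_iter C (Suc n)"
  have comm: "X o\<^sub>L Y = Y o\<^sub>L X"
    unfolding X_def Y_def by (intro sqrt_iter_commute) (metis sqrt_iter_commute)
  have "sqrt_iter C (Suc (Suc n)) - Y = (1/2) *\<^sub>R ((Y - X) o\<^sub>L (Y + X))"
    unfolding sqrt_iter.simps(2)[of C "Suc n"] Y_def[symmetric]
    by (simp add: blinfun_compose_expand comm) (simp add: Y_def X_def algebra_simps)
  moreover have "norm ((Y - X) o\<^sub>L (Y + X))
      \<le> (sqrt_bound (Suc n) - sqrt_bound n) * (sqrt_bound (Suc n) + sqrt_bound n)"
  proof (rule order_trans[OF norm_blinfun_compose], rule mult_mono)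
    show "norm (Y - X) \<le> sqrt_bound (Suc n) - sqrt_bound n"
      using Suc by (simp only: X_def Y_def)
    show "norm (Y + X) \<le> sqrt_bound (Suc n) + sqrt_bound n"
      using norm_triangle_ineq[of Y X] norm_sqrt_iter[OF C, of n] norm_sqrt_iter[OF C, of "Suc n"]
      unfolding X_def Y_def by linarith
    show "0 \<le> sqrt_bound (Suc n) - sqrt_bound n"
      using sqrt_bound_mono incseq_SucD by force
  qed simp
  moreover have "(sqrt_bound (Suc n) - sqrt_bound n) * (sqrt_bound (Suc n) + sqrt_bound n)
      = 2 * (sqrt_bound (Suc (Suc n)) - sqrt_bound (Suc n))"
    unfolding sqrt_bound.simps(2)[of "Suc n"]
    by (simp add: algebra_simps power2_eq_square)
  ultimately show ?case
    unfolding Y_def[symmetric] by (simp del: sqrt_iter.simps sqrt_bound.simps)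
qed

lemma sqrt_iter_convergent:
  assumes C: "norm C \<le> 1"
  shows "convergent (sqrt_iter C)"
proof -
  have "convergent sqrt_bound"
    using sqrt_bound_mono sqrt_bound_range by (metis incseq_convergent convergentI)
  then obtain l where "sqrt_bound \<longlonglongrightarrow> l" by (auto simp: convergent_def)
  then have "summable (\<lambda>n. sqrt_bound (Suc n) - sqrt_bound n)"
    by (rule telescope_summable)
  then have "summable (\<lambda>n. sqrt_iter C (Suc n) - sqrt_iter C n)"
    by (rule summable_comparison_test') (rule norm_sqrt_iter_diff[OF C])
  then show ?thesis
    unfolding summable_iff_convergent sum_lessThan_telescope by simp
qed

text \<open>Symmetry and commutation hold for every iterate and pass to the norm limit
  \<open>X\<close>, a fixed point of the iteration.\<close>

lemma contraction_sqrt: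
  fixes C :: "'a::complex_hilbert \<Rightarrow>\<^sub>L 'a"
  assumes C: "norm C \<le> 1" and sym: "\<And>x y. rinner (C x) y = rinner x (C y)"
  obtains X where "norm X \<le> 1" "X + X = C + (X o\<^sub>L X)"
    "\<And>x y. rinner (X x) y = rinner x (X y)"
    "\<And>D. D o\<^sub>L C = C o\<^sub>L D \<Longrightarrow> D o\<^sub>L X = X o\<^sub>L D"
proof -
  obtain X where X: "sqrt_iter C \<longlonglongrightarrow> X"
    using sqrt_iter_convergent[OF C] by (auto simp: convergent_def)
  note comp = bounded_bilinear.tendsto[OF bounded_bilinear_blinfun_compose]
  note app = bounded_bilinear.tendsto[OF bounded_bilinear_blinfun_apply X tendsto_const]
  show thesis
  proof (rule that)
    show "norm X \<le> 1"
    proof (rule LIMSEQ_le_const2[OF tendsto_norm[OF X]])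
      show "\<exists>N. \<forall>n\<ge>N. norm (sqrt_iter C n) \<le> 1"
        using norm_sqrt_iter[OF C] sqrt_bound_range order_trans by blast
    qed
    have "(\<lambda>n. sqrt_iter C (Suc n)) \<longlonglongrightarrow> (1/2) *\<^sub>R (C + (X o\<^sub>L X))"
      unfolding sqrt_iter.simps by (intro tendsto_intros comp X)
    then have "X = (1/2) *\<^sub>R (C + (X o\<^sub>L X))"
      using LIMSEQ_unique LIMSEQ_Suc[OF X] by blast
    then show "X + X = C + (X o\<^sub>L X)"
      by (metis field_sum_of_halves scaleR_add_left scaleR_one)
    have "rinner (sqrt_iter C n x) y = rinner x (sqrt_iter C n y)" for n x y
      by (induction n arbitrary: x y)
        (simp_all add: rinner_expand rinner.zero_left rinner.zero_right sym
          plus_blinfun.rep_eq scaleR_blinfun.rep_eq)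
    then have "(\<lambda>n. rinner (sqrt_iter C n x) y) \<longlonglongrightarrow> rinner x (X y)" for x y
      by (simp add: rinner.tendsto[OF tendsto_const app])
    moreover have "(\<lambda>n. rinner (sqrt_iter C n x) y) \<longlonglongrightarrow> rinner (X x) y" for x y
      by (rule rinner.tendsto[OF app tendsto_const])
    ultimately show "rinner (X x) y = rinner x (X y)" for x y
      using LIMSEQ_unique by blast
    show "D o\<^sub>L X = X o\<^sub>L D" if "D o\<^sub>L C = C o\<^sub>L D" for D
      using LIMSEQ_unique[OF comp[OF tendsto_const X, of D] ] comp[OF X tendsto_const, of D]
        sqrt_iter_commute[OF that] by simp
  qed
qed

text \<open>For large \<open>k\<close> the operator \<open>1 - A / k\<close> is a symmetric
  contraction; with \<open>X\<close> from \<open>contraction_sqrt\<close> the root is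
  \<open>sqrt k\<close> times \<open>1 - X\<close>. The commutation clause serves the uniqueness of
  the root.\<close>

lemma positive_op_sqrt_exists:
  fixes A :: "'a::complex_hilbert \<Rightarrow> 'a"
  assumes A: "positive_op A"
  obtains B where "positive_op B" "B \<circ> B = A"
    "\<And>D. bounded_linear D \<Longrightarrow> D \<circ> A = A \<circ> D \<Longrightarrow> D \<circ> B = B \<circ> D"
proof -
  \<comment> \<open>The added 1 keeps \<open>k\<close> positive when \<open>A\<close> is
    zero.\<close>
  define k where "k = onorm A + 1"
  interpret A: bounded_linear A using A by (rule positive_op_bounded_linear)
  have AC: "A (c *\<^sub>C x) = c *\<^sub>C A x" for c x
    using A by (simp add: positive_op_def bounded_ops_UNIV_iff)
  have k: "0 < k" using onorm_pos_le[OF A.bounded_linear_axioms] by (simp add: k_def)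
  have Ak: "rinner (A x) x \<le> k * (norm x)\<^sup>2" for x
  proof -
    have "rinner (A x) x \<le> norm (A x) * norm x" by (rule rinner_le)
    also have "\<dots> \<le> (onorm A * norm x) * norm x"
      by (intro mult_right_mono onorm A.bounded_linear_axioms) simp
    also have "\<dots> \<le> k * (norm x)\<^sup>2" by (simp add: k_def power2_eq_square algebra_simps)
    finally show ?thesis .
  qed
  define c where "c x = x - (1/k) *\<^sub>R A x" for x
  have c_lin: "bounded_linear c"
    unfolding c_def by (intro bounded_linear_intros A.bounded_linear_axioms)
  have c_sym: "rinner (c x) y = rinner x (c y)" for x y
    by (simp add: c_def rinner_expand positive_op_rinner[OF A])
  have c_inner: "rinner (c x) x = (norm x)\<^sup>2 - rinner (A x) x / k" for x
    by (simp add: c_def rinner_expand rinner_self)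
  have c_pos: "positive_op c"
  proof (rule positive_opI[OF _ c_sym])
    show "c \<in> bounded_ops UNIV UNIV"
      using c_lin
      by (simp add: bounded_ops_UNIV_iff c_def AC linear_simps[OF bounded_linear_scaleC])
    show "0 \<le> rinner (c x) x" for x
      unfolding c_inner using Ak[of x] k by (simp add: field_simps)
  qed
  have c_le: "rinner (c x) x \<le> (norm x)\<^sup>2" for x
    unfolding c_inner using positive_op_nonneg[OF A, of x] k by simp
  have c_norm: "norm (c x) \<le> norm x" for x
  proof (rule power2_le_imp_le)
    have "(norm (c x))\<^sup>2 \<le> 1 * rinner (c x) x"
      using c_le by (intro positive_op_norm_square_le c_pos) simp
    then show "(norm (c x))\<^sup>2 \<le> (norm x)\<^sup>2" using c_le[of x] by linarith
  qed simp
  define C where "C = Blinfun c"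
  have C [simp]: "blinfun_apply C = c" by (simp add: C_def bounded_linear_Blinfun_apply c_lin)
  have "norm C \<le> 1" using c_norm by (intro norm_blinfun_bound) auto
  then obtain X where X: "norm X \<le> 1" "X + X = C + (X o\<^sub>L X)"
    "\<And>x y. rinner (X x) y = rinner x (X y)"
    and comm: "\<And>D. D o\<^sub>L C = C o\<^sub>L D \<Longrightarrow> D o\<^sub>L X = X o\<^sub>L D"
    using contraction_sqrt c_sym C by metis
  have comm': "D (X x) = X (D x)" if D: "bounded_linear D" and DA: "\<And>x. D (A x) = A (D x)" for D x
  proof -
    have "Blinfun D o\<^sub>L C = C o\<^sub>L Blinfun D"
      by (rule blinfun_eqI)
        (simp add: bounded_linear_Blinfun_apply[OF D] c_def linear_simps[OF D] DA)
    from comm[OF this] show ?thesis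
      by (metis D bounded_linear_Blinfun_apply blinfun_apply_blinfun_compose)
  qed
  define B where "B x = sqrt k *\<^sub>R (x - X x)" for x
  have B_lin: "bounded_linear B"
    unfolding B_def by (intro bounded_linear_intros)
  show thesis
  proof (rule that)
    show "positive_op B"
    proof (rule positive_opI)
      \<comment> \<open>Multiplication by the complex scalar \<open>a\<close> is bounded, real
        linear and commutes with \<open>A\<close>, hence with \<open>X\<close>; this gives complex
        linearity.\<close>
      have "X (a *\<^sub>C x) = a *\<^sub>C X x" for a x
        using comm'[OF bounded_linear_scaleC, of a] AC by simp
      then show "B \<in> bounded_ops UNIV UNIV"
        using B_lin
        by (simp add: bounded_ops_UNIV_iff B_def linear_simps[OF bounded_linear_scaleC])
      show "rinner (B x) y = rinner x (B y)" for x y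
        by (simp add: B_def rinner_expand X)
      have "rinner (X x) x \<le> (norm x)\<^sup>2" for x
      proof -
        have "rinner (X x) x \<le> norm (X x) * norm x" by (rule rinner_le)
        also have "norm (X x) \<le> 1 * norm x"
          using norm_blinfun[of X x] X(1) by (meson mult_right_mono norm_ge_zero order_trans)
        finally show ?thesis by (simp add: power2_eq_square mult_right_mono)
      qed
      then show "0 \<le> rinner (B x) x" for x
        using k by (simp add: B_def rinner_expand rinner_self)
    qed
    show "B \<circ> B = A"
    proof
      fix x
      have "X x + X x = c x + X (X x)"
        using arg_cong[OF X(2), of "\<lambda>Y. blinfun_apply Y x"] by (simp add: plus_blinfun.rep_eq)
      then have "x - X x - X (x - X x) = (1/k) *\<^sub>R A x"
        by (simp add: c_def blinfun.diff_right algebra_simps)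
      then have "k *\<^sub>R (x - X x - X (x - X x)) = A x" using k by simp
      moreover have "(B \<circ> B) x = (sqrt k * sqrt k) *\<^sub>R (x - X x - X (x - X x))"
        by (simp add: B_def blinfun.scaleR_right blinfun.diff_right scaleR_diff_right)
      ultimately show "(B \<circ> B) x = A x" using k by simp
    qed
    show "D \<circ> B = B \<circ> D" if D: "bounded_linear D" and DA: "D \<circ> A = A \<circ> D" for D
    proof
      fix x
      show "(D \<circ> B) x = (B \<circ> D) x"
        using comm'[OF D] DA
        by (simp add: B_def fun_eq_iff linear_simps[OF D])
    qed
  qed
qed

text \<open>Commutation gives \<open>(B + B') (B - B') = 0\<close>. Both positive forms therefore
  vanish at \<open>y = B x - B' x\<close>, so \<open>B\<close> and \<open>B'\<close> kill
  \<open>y\<close>, and by symmetry \<open>y\<close> is orthogonal to itself.\<close>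

lemma positive_op_sqrt_unique:
  assumes B: "positive_op B" and B': "positive_op B'"
    and sq: "B \<circ> B = B' \<circ> B'" and comm: "B' \<circ> B = B \<circ> B'"
  shows "B' = B"
proof
  fix x
  note lin = linear_simps[OF positive_op_bounded_linear[OF B]]
    linear_simps[OF positive_op_bounded_linear[OF B']]
  define y where "y = B x - B' x"
  have "B y + B' y = 0"
    using fun_cong[OF sq, of x] fun_cong[OF comm, of x] by (simp add: y_def lin)
  then have "rinner (B y) y + rinner (B' y) y = 0"
    by (simp add: rinner.zero_left flip: rinner.add_left)
  then have "rinner (B y) y = 0" "rinner (B' y) y = 0"
    using positive_op_nonneg[OF B, of y] positive_op_nonneg[OF B', of y] by linarith+
  then have "B y = 0" "B' y = 0"
    using positive_op_eq_0 B B' by metis+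
  moreover have "(norm y)\<^sup>2 = rinner (B y - B' y) x"
    by (simp add: y_def rinner_expand lin positive_op_rinner[OF B] positive_op_rinner[OF B']
        flip: rinner_self)
  ultimately show "B' x = B x" by (simp add: rinner.zero_left y_def)
qed

text \<open>Any positive root \<open>B'\<close> commutes with \<open>A = B' \<circ> B'\<close>,
  hence with the constructed root, so uniqueness reduces to the commuting case.\<close>

lemma op_sqrt:
  assumes A: "positive_op A"
  shows "positive_op (op_sqrt A) \<and> op_sqrt A \<circ> op_sqrt A = A"
proof -
  obtain B where B: "positive_op B" "B \<circ> B = A"
    and comm: "\<And>D. bounded_linear D \<Longrightarrow> D \<circ> A = A \<circ> D \<Longrightarrow> D \<circ> B = B \<circ> D"
    using positive_op_sqrt_exists[OF A] by blast
  have unique: "B' = B" if B': "positive_op B' \<and> B' \<circ> B' = A" for B'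
  proof (rule positive_op_sqrt_unique)
    show "B' \<circ> B = B \<circ> B'"
      using B' by (intro comm positive_op_bounded_linear) auto
  qed (use B B' in auto)
  from B have "op_sqrt A = B" 
    unfolding op_sqrt_def by (intro the_equality unique) auto
  with B show ?thesis by simp
qed

section \<open>Absolute value and real part of an operator\<close>

lemma op_abs:
  assumes T: "T \<in> bounded_ops UNIV UNIV"
  shows op_abs_positive: "positive_op (op_abs T)"
    and op_abs_square: "op_abs T (op_abs T x) = cadjoint T (T x)"
proof -
  note lin = T cadjoint_bounded_ops[OF T]
  have "positive_op (cadjoint T \<circ> T)"
  proof (rule positive_opI)
    show "cadjoint T \<circ> T \<in> bounded_ops UNIV UNIV"
      using lin by (auto simp: bounded_ops_UNIV_iff o_def intro: bounded_linear_compose)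
    show "rinner ((cadjoint T \<circ> T) x) y = rinner x ((cadjoint T \<circ> T) y)" for x y
      using rinner_cadjoint[OF T] rinner_commute by (metis comp_apply)
    show "0 \<le> rinner ((cadjoint T \<circ> T) x) x" for x
    proof -
      have "rinner ((cadjoint T \<circ> T) x) x = rinner (T x) (T x)"
        by (simp add: rinner_cadjoint[OF T] rinner_commute[of _ x])
      then show ?thesis by (simp add: rinner_self)
    qed
  qed
  then show "positive_op (op_abs T)" "op_abs T (op_abs T x) = cadjoint T (T x)"
    using op_sqrt[of "cadjoint T \<circ> T"] by (auto simp: op_abs_def o_def fun_eq_iff)
qed

text \<open>Both squared norms equal the form of \<open>cadjoint T \<circ> T\<close> at
  \<open>x\<close>. Norms of absolute values can thus be computed without the square root.\<close>

lemma norm_op_abs: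
  assumes T: "T \<in> bounded_ops UNIV UNIV"
  shows "norm (op_abs T x) = norm (T x)"
proof -
  have "rinner (op_abs T x) (op_abs T x) = rinner (T x) (T x)"
    by (simp add: positive_op_rinner[OF op_abs_positive[OF T]] op_abs_square[OF T]
        rinner_cadjoint[OF T])
  then show ?thesis by (simp add: rinner_self)
qed

lemma op_Re_bounded_ops:
  assumes T: "T \<in> bounded_ops UNIV UNIV"
  shows "op_Re T \<in> bounded_ops UNIV UNIV"
  using T cadjoint_bounded_ops[OF T]
  by (auto simp: bounded_ops_UNIV_iff op_Re_def scaleC_scaleC mult.commute
      intro!: bounded_linear_compose[OF bounded_linear_scaleC] bounded_linear_add
      simp flip: scaleC_add_right)

lemma norm_op_Re: "norm (op_Re T x) = norm (T x + cadjoint T x) / 2"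
  by (simp add: op_Re_def norm_scaleC)

section \<open>Operators with \<open>|T| \<le> |Re T|\<close>\<close>

lemma orth_compl_rinner: "y \<in> orth_compl G \<Longrightarrow> x \<in> G \<Longrightarrow> rinner y x = 0"
  by (simp add: orth_compl_def rinner_def)

text \<open>\<open>G\<close> is invariant under \<open>\<i>\<close>, so real orthogonality to
  \<open>G\<close> is already complex orthogonality.\<close>

lemma orth_compl_decomp:
  fixes G :: "'a::complex_hilbert set"
  assumes G: "closed_csubspace G"
  obtains x y where "x \<in> G" "y \<in> orth_compl G" "z = x + y"
proof -
  obtain x y where xy: "x \<in> G" "z = x + y" and y: "\<And>v. v \<in> G \<Longrightarrow> rinner y v = 0"
    using G closed_subspace_orth_decomp[of G z] by (auto simp: closed_csubspace_def)
  have "cinner y v = 0" if "v \<in> G" for v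
  proof -
    have "\<i> *\<^sub>C v \<in> G" using that G by (simp add: closed_csubspace_def)
    then have "Re (cinner y (\<i> *\<^sub>C v)) = 0" using y by (simp add: rinner_def)
    then show ?thesis
      using y[OF that] by (simp add: rinner_def cinner_scaleC_right complex_eq_iff)
  qed
  then show thesis using that xy by (auto simp: orth_compl_def)
qed

text \<open>This concerns a single vector at which \<open>T\<close> attains its norm; the isometry
  hypothesis on \<open>S\<close> makes every vector of \<open>G\<close> such a vector.\<close>

lemma cadjoint_eq_on_norm_attaining:
  assumes T: "T \<in> bounded_ops UNIV UNIV"
    and le: "\<And>x. rinner (op_abs T x) x \<le> rinner (op_abs (op_Re T) x) x"
    and g: "norm (T g) = onorm T * norm g"
  shows "cadjoint T g = T g" and "op_abs T g = onorm T *\<^sub>R g"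
proof -
  define t where "t = onorm T"
  have lin: "bounded_linear T" using T by (simp add: bounded_ops_UNIV_iff)
  have t: "0 \<le> t" using onorm_pos_le[OF lin] by (simp add: t_def)
  note bound = onorm[OF lin, folded t_def]
  let ?A = "op_abs T" and ?B = "op_abs (op_Re T)"
  \<comment> \<open>The operator norm also bounds \<open>?A\<close>, so
    \<open>(norm (?A g))\<^sup>2 \<le> t * rinner (?A g) g\<close>, where the left side is
    \<open>(t * norm g)\<^sup>2\<close>; one factor \<open>t\<close> is then cancelled.\<close>
  have ge: "t * (norm g)\<^sup>2 \<le> rinner (?A g) g"
  proof (cases "t = 0")
    case True
    then show ?thesis using positive_op_nonneg[OF op_abs_positive[OF T]] by simp
  next
    case False
    have "rinner (?A (?A g)) (?A g) \<le> norm (?A (?A g)) * norm (?A g)" by (rule rinner_le)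
    also have "\<dots> \<le> t * norm (?A g) * norm (?A g)"
      by (intro mult_right_mono) (simp_all add: norm_op_abs[OF T, of "?A g"] bound)
    finally have "(norm (?A g))\<^sup>2 \<le> t * rinner (?A g) g"
      by (intro positive_op_norm_square_le op_abs_positive T) (simp add: power2_eq_square mult.assoc)
    then have "t * (t * (norm g)\<^sup>2) \<le> t * rinner (?A g) g"
      by (simp add: norm_op_abs[OF T] g[folded t_def] power_mult_distrib power2_eq_square mult_ac)
    then show ?thesis using False t by simp
  qed
  have "(norm (?A g - t *\<^sub>R g))\<^sup>2 = 2 * t * (t * (norm g)\<^sup>2 - rinner (?A g) g)"
    by (simp add: norm_diff_square norm_op_abs[OF T] g[folded t_def] rinner_expand
        power_mult_distrib) (simp add: power2_eq_square algebra_simps)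
  also have "\<dots> \<le> 0" using ge t by (simp add: mult_nonneg_nonpos)
  finally show "?A g = onorm T *\<^sub>R g" by (simp add: t_def)
  \<comment> \<open>Cauchy-Schwarz turns the lower bound on the form of \<open>?B\<close> into one
    on \<open>norm (?B g)\<close>, which is half of
    \<open>norm (T g + cadjoint T g)\<close>.\<close>
  have "t * norm g * norm g \<le> norm (?B g) * norm g"
    using ge le[of g] rinner_le[of "?B g" g] by (simp add: power2_eq_square)
  then have "2 * (t * norm g) \<le> norm (T g + cadjoint T g)"
    using norm_op_abs[OF op_Re_bounded_ops[OF T], of g] by (cases "g = 0") (auto simp: norm_op_Re)
  then have 1: "(2 * (t * norm g))\<^sup>2 \<le> (norm (T g + cadjoint T g))\<^sup>2"
    using t by (intro power_mono) auto
  have 2: "(norm (cadjoint T g))\<^sup>2 \<le> (t * norm g)\<^sup>2"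
    using norm_cadjoint_le[OF T] t by (simp add: t_def power_mono)
  have "(norm (T g - cadjoint T g))\<^sup>2
      = 2 * (t * norm g)\<^sup>2 + 2 * (norm (cadjoint T g))\<^sup>2 - (norm (T g + cadjoint T g))\<^sup>2"
    by (simp add: norm_diff_square norm_add_square g[folded t_def])
  also have "\<dots> \<le> 0" using 1 2 by (simp add: power_mult_distrib)
  finally show "cadjoint T g = T g" by simp
qed

text \<open>Any bound \<open>c\<close> for \<open>T\<close> on \<open>K\<close> improves to \<open>c / 2\<close>: a vector \<open>x\<close> in the image of
  \<open>K\<close> under \<open>T\<^sup>*\<close> satisfies \<open>T\<^sup>* x = 0\<close>, so \<open>|Re T|\<close> only sees half of \<open>T x\<close>.\<close>

lemma square_zero_on_reducing:
  assumes T: "T \<in> bounded_ops UNIV UNIV"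
    and le: "\<And>x. rinner (op_abs T x) x \<le> rinner (op_abs (op_Re T) x) x"
    and TK: "\<And>y. y \<in> K \<Longrightarrow> T y \<in> K" and T'K: "\<And>y. y \<in> K \<Longrightarrow> cadjoint T y \<in> K"
    and AK: "\<And>y. y \<in> K \<Longrightarrow> op_abs T y \<in> K"
    and sq: "\<And>y. y \<in> K \<Longrightarrow> T (T y) = 0"
    and y: "y \<in> K"
  shows "T y = 0"
proof -
  define t where "t = onorm T"
  have lin: "bounded_linear T" using T by (simp add: bounded_ops_UNIV_iff)
  have t: "0 \<le> t" using onorm_pos_le[OF lin] by (simp add: t_def)
  let ?T' = "cadjoint T" and ?A = "op_abs T" and ?B = "op_abs (op_Re T)"
  \<comment> \<open>The square-zero property passes to the adjoint by duality, as \<open>K\<close>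
    is invariant under \<open>?T'\<close>.\<close>
  have sq': "?T' (?T' y) = 0" if "y \<in> K" for y
  proof -
    let ?z = "?T' (?T' y)"
    have "(norm ?z)\<^sup>2 = rinner (T (T ?z)) y"
      by (simp add: rinner_cadjoint[OF T] flip: rinner_self)
    also have "\<dots> = 0" using that by (simp add: sq T'K rinner.zero_left)
    finally show ?thesis by simp
  qed
  have half: "norm (T y) \<le> c / 2 * norm y"
    if c: "0 \<le> c" and bound: "\<And>y. y \<in> K \<Longrightarrow> norm (T y) \<le> c * norm y" and y: "y \<in> K" for c y
  proof -
    have 1: "norm (T (?T' y)) \<le> c / 2 * norm (?T' y)" if y: "y \<in> K" for y
    proof -
      define x where "x = ?T' y"
      have x: "x \<in> K" "?T' x = 0" using y by (simp_all add: x_def T'K sq')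
      have "rinner (?A (?A x)) (?A x) \<le> norm (?A (?A x)) * norm (?A x)" by (rule rinner_le)
      also have "\<dots> \<le> c * norm (?A x) * norm (?A x)"
        by (intro mult_right_mono) (simp_all add: norm_op_abs[OF T, of "?A x"] bound AK x)
      finally have "(norm (?A x))\<^sup>2 \<le> c * rinner (?A x) x"
        by (intro positive_op_norm_square_le op_abs_positive T)
          (simp add: power2_eq_square mult.assoc)
      also have "\<dots> \<le> c * rinner (?B x) x" using c le by (intro mult_left_mono)
      also have "\<dots> \<le> c * (norm (?B x) * norm x)" using c by (intro mult_left_mono rinner_le)
      also have "norm (?B x) = norm (T x) / 2"
        using x by (simp add: norm_op_abs op_Re_bounded_ops T norm_op_Re)
      finally have "norm (T x) * norm (T x) \<le> norm (T x) * (c / 2 * norm x)"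
        by (simp add: norm_op_abs[OF T] power2_eq_square mult_ac)
      then have "norm (T x) \<le> c / 2 * norm x"
        using c by (cases "T x = 0") (simp_all add: mult_le_cancel_left)
      then show ?thesis by (simp add: x_def)
    qed
    \<comment> \<open>Writing the squared norm of \<open>?T' y\<close> through
      \<open>T (?T' y)\<close> transfers the halved bound from \<open>T\<close> on the image of
      \<open>?T'\<close> to \<open>?T'\<close> on all of \<open>K\<close>; the same duality then
      returns it to \<open>T\<close>.\<close>
    have 2: "norm (?T' y) \<le> c / 2 * norm y" if y: "y \<in> K" for y
    proof -
      have "norm (?T' y) * norm (?T' y) = rinner (T (?T' y)) y"
        by (simp add: rinner_cadjoint[OF T] rinner_self power2_eq_square)
      also have "\<dots> \<le> norm (T (?T' y)) * norm y" by (rule rinner_le)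
      also have "\<dots> \<le> c / 2 * norm (?T' y) * norm y" by (intro mult_right_mono 1 y) simp
      also have "\<dots> = norm (?T' y) * (c / 2 * norm y)" by simp
      finally show ?thesis
        using c by (cases "?T' y = 0") (simp_all add: mult_le_cancel_left)
    qed
    have "norm (T y) * norm (T y) = rinner y (?T' (T y))"
      by (simp add: rinner_self power2_eq_square flip: rinner_cadjoint[OF T])
    also have "\<dots> \<le> norm y * norm (?T' (T y))" by (rule rinner_le)
    also have "\<dots> \<le> norm y * (c / 2 * norm (T y))" by (intro mult_left_mono 2 TK y) simp
    also have "\<dots> = norm (T y) * (c / 2 * norm y)" by simp
    finally show ?thesis
      using c by (cases "T y = 0") (simp_all add: mult_le_cancel_left)
  qed
  have iter: "\<forall>y\<in>K. norm (T y) \<le> t * (1/2)^n * norm y" for n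
  proof (induction n)
    case 0
    show ?case using onorm[OF lin] by (simp add: t_def)
  next
    case (Suc n)
    then show ?case using half[of "t * (1/2)^n"] t by simp
  qed
  have "(\<lambda>n. t * (1/2)^n * norm y) \<longlonglongrightarrow> t * 0 * norm y"
    by (intro tendsto_intros LIMSEQ_power_zero) simp
  then have "norm (T y) \<le> t * 0 * norm y"
    by (rule LIMSEQ_le_const) (use iter y in blast)
  then show ?thesis by simp
qed

theorem proposition3p3:
  fixes T S R Q :: "'a::complex_hilbert \<Rightarrow> 'a" and G :: "'a set"
  assumes T: "T \<in> bounded_ops UNIV UNIV" "T \<noteq> (\<lambda>x. 0)"
    and G: "closed_csubspace G"
    and block: "has_block_form G T S R (\<lambda>x. 0) Q"
    and S: "isometry_on G (\<lambda>x. (1 / onorm T) *\<^sub>R S x)"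
    and RQ: "inj_on R (orth_compl G) \<or> (\<forall>y\<in>orth_compl G. Q (Q y) = 0)"
    and le: "op_le (op_abs T) (op_abs (op_Re T))"
  shows "selfadjoint_op T"
proof -
  let ?T' = "cadjoint T" and ?K = "orth_compl G"
  have lin: "bounded_linear T" and lin': "bounded_linear ?T'"
    using T cadjoint_bounded_ops[OF T(1)] by (simp_all add: bounded_ops_UNIV_iff)
  \<comment> \<open>Positivity permits undoing the scaling of \<open>S\<close>; for
    \<open>T = 0\<close> the factor \<open>1 / onorm T\<close> would be 0.\<close>
  have t: "0 < onorm T" using onorm_pos_lt[OF lin] T(2) by auto
  have le': "rinner (op_abs T x) x \<le> rinner (op_abs (op_Re T) x) x" for x
    using le positive_op_nonneg[of "\<lambda>x. op_abs (op_Re T) x - op_abs T x" x]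
    by (simp add: op_le_def rinner.diff_left)
  have G0: "0 \<in> G" using G by (simp add: closed_csubspace_def subspace_0)
  have K0: "0 \<in> ?K"
    by (simp add: orth_compl_def cinner_zero_left)
  have blk: "T (x + y) = S x + R y + Q y" if "x \<in> G" "y \<in> ?K" for x y
    using block that by (simp add: has_block_form_def add.assoc)
  have SG: "S x \<in> G" if "x \<in> G" for x
    using block that by (simp add: has_block_form_def bounded_ops_def)
  have RG: "R y \<in> G" and QK: "Q y \<in> ?K" if "y \<in> ?K" for y
    using block that by (simp_all add: has_block_form_def bounded_ops_def)
  have add0: "f 0 = 0" if "f \<in> bounded_ops V W" "0 \<in> V" for f :: "'a \<Rightarrow> 'a" and V W
  proof -
    have "f (0 + 0) = f 0 + f 0" using that unfolding bounded_ops_def by blast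
    then show ?thesis by simp
  qed
  have S0: "S 0 = 0" and R0: "R 0 = 0" and Q0: "Q 0 = 0"
    using block by (auto simp: has_block_form_def intro: add0 G0 K0)
  have TG: "T x = S x" if "x \<in> G" for x
    using blk[OF that K0] by (simp add: R0 Q0)
  have attain: "norm (T x) = onorm T * norm x" if "x \<in> G" for x
    using S that t by (simp add: isometry_on_def TG field_simps)
  note eqG = cadjoint_eq_on_norm_attaining[OF T(1) le' attain]
  \<comment> \<open>\<open>Q y\<close> is orthogonal to \<open>R y\<close>, so \<open>T y\<close>
    and \<open>y\<close> can replace \<open>R y\<close> after moving \<open>T\<close> across: on
    \<open>G\<close> the adjoint acts as \<open>S\<close>, whose values in \<open>G\<close> are
    orthogonal to \<open>y\<close>.\<close>
  have RK: "R y = 0" if y: "y \<in> ?K" for y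
  proof -
    have "rinner (R y) (R y) = rinner (T y) (R y)"
      using blk[OF G0 y] orth_compl_rinner[OF QK RG, OF y y] by (simp add: S0 rinner.add_left)
    also have "\<dots> = rinner y (S (R y))"
      by (simp add: rinner_cadjoint[OF T(1)] eqG RG TG y)
    also have "\<dots> = 0" using orth_compl_rinner[OF y SG[OF RG[OF y]]] .
    finally show ?thesis by (simp add: rinner_self)
  qed
  have TQ: "T y = Q y" if "y \<in> ?K" for y
    using blk[OF G0 that] RK[OF that] by (simp add: S0)
  have eqK: "?T' y = T y" if y: "y \<in> ?K" for y
    using RQ
  proof
    assume "inj_on R ?K"
    \<comment> \<open>\<open>R\<close> is both zero and injective on \<open>?K\<close>, so
      \<open>?K\<close> is trivial.\<close>
    then have "y = 0" using RK y K0 R0 by (metis inj_onD)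
    then show ?thesis using lin lin' by (simp add: linear_simps)
  next
    assume sq: "\<forall>y\<in>?K. Q (Q y) = 0"
    have K_cinner: "cinner z x = 0" if "z \<in> ?K" "x \<in> G" for z x
      using that by (simp add: orth_compl_def)
    \<comment> \<open>\<open>T\<close> maps \<open>G\<close> into itself, so its adjoint preserves
      the orthogonal complement.\<close>
    have T'K: "?T' z \<in> ?K" if "z \<in> ?K" for z
    proof -
      have "cinner (?T' z) x = 0" if "x \<in> G" for x
      proof -
        have "cinner (?T' z) x = cnj (cinner (T x) z)"
          by (simp add: cinner_cadjoint[OF T(1)] flip: cinner_commute)
        also have "\<dots> = cinner z (S x)"
          by (simp add: TG[OF that] flip: cinner_commute)
        also have "\<dots> = 0"
          using K_cinner[OF \<open>z \<in> ?K\<close> SG[OF that]] .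
        finally show ?thesis .
      qed
      then show ?thesis by (simp add: orth_compl_def)
    qed
    \<comment> \<open>The symmetric operator \<open>op_abs T\<close> acts on \<open>G\<close> as a
      scalar, hence preserves the complement.\<close>
    have AK: "op_abs T z \<in> ?K" if "z \<in> ?K" for z
      using that
      by (auto simp: orth_compl_def positive_op_cinner[OF op_abs_positive[OF T(1)]] eqG
          cinner_scaleC_right simp flip: scaleC_of_real)
    have T0: "T z = 0" if "z \<in> ?K" for z
      by (rule square_zero_on_reducing[OF T(1) le', where K = ?K])
        (use that sq T'K AK in \<open>simp_all add: TQ QK\<close>)
    \<comment> \<open>\<open>T\<close> vanishes on \<open>?K\<close>, which contains
      \<open>?T' y\<close>, so the adjoint vanishes there too.\<close>
    have "norm (?T' y) ^ 2 = rinner (T (?T' y)) y"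
      by (simp add: rinner_cadjoint[OF T(1)] rinner_self)
    then show ?thesis using T0 T'K y by (simp add: rinner.zero_left)
  qed
  have "?T' = T"
  proof
    fix z
    obtain x y where "x \<in> G" "y \<in> ?K" "z = x + y" by (rule orth_compl_decomp[OF G])
    then show "?T' z = T z"
      using eqG(1) eqK lin lin' by (simp add: linear_simps)
  qed
  then show ?thesis using T(1) by (simp add: selfadjoint_op_def)
qed

end
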